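(* For every $\delta>0$ and $c>0$ there is a constant $C=C(\delta,c)>0$ with the following property. Let $A\subset\mathbb{N}$ be a finite nonempty set of positive integers and let $G\subset A\times A$ satisfy $|G|>\delta|A|^2$. If $|A\overset{G}{\times}A|<c|A|$, then $|A\overset{G}{+}A|>C(\delta,c)|A|^2$.
   Context: For $G\subset A\times A$, the restricted sum set is $A\overset{G}{+}A=\{a+a' : (a,a')\in G\}$ and the restricted product set is $A\overset{G}{\times}A=\{aa' : (a,a')\in G\}$. *)

theory Defs
  imports Complex_Main
begin

text \<open>
  Here \<open>G\<close> is the edge set of the restriction; the ambient set \<open>A\<close> with \<open>G \<subseteq> A \<times> A\<close> does not
  occur in the right-hand sides and is therefore not a parameter.
\<close>

definition restricted_sumset :: "('a::plus \<times> 'a) set \<Rightarrow> 'a set" where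
  "restricted_sumset G = {a + a' | a a'. (a, a') \<in> G}"

definition restricted_prodset :: "('a::times \<times> 'a) set \<Rightarrow> 'a set" where
  "restricted_prodset G = {a * a' | a a'. (a, a') \<in> G}"

end

theory Submission
  imports Defs "HOL-Analysis.Convex" "HOL-Computational_Algebra.Primes" "HOL-Library.Function_Algebras"
begin

text \<open>
  Write positive integers as vectors of prime valuations, so that products become sums of vectors.
  Dependent random choice (as in the Balog--Szemeredi--Gowers theorem) yields a subset \<open>M\<close> of positive
  proportion, of large degree in \<open>G\<close>, whose valuation vectors have a small difference set. If \<open>P\<close> is
  the set of popular differences, then \<open>M + P - P + P\<close> is small, so Ruzsa covering gives a bounded set
  \<open>X\<close> with \<open>M + (P - P) \<subseteq> X + (P - P)\<close>. Iterating, all multiples of an element of \<open>M\<close> lie in finitely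
  many cosets of the group generated by \<open>X\<close>; hence \<open>M\<close> lies in the rational span \<open>V\<close> of \<open>X\<close>. Sums of \<open>M\<close>
  with distinct cosets of \<open>V\<close> are disjoint, so few cosets meet the vertices of large degree into \<open>M\<close>,
  and one of them carries a positive proportion of the edges.

  It remains to bound the additive energy of a set \<open>A\<close> of integers whose valuations lie in a coset of
  a space of dimension \<open>d\<close> by \<open>36 ^ d * (card A)\<^sup>2\<close> (Chang). In a solution of
  \<open>x\<^sub>1 + x\<^sub>2 = x\<^sub>3 + x\<^sub>4\<close> two of the four \<open>p\<close>-adic valuations agree, so with the fibres \<open>F j\<close> of the
  valuation at \<open>p\<close>, Cauchy--Schwarz gives \<open>sqrt (energy A) \<le> 6 * (\<Sum>j. sqrt (energy (F j)))\<close>, and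
  fixing the valuation at a suitable prime lowers \<open>d\<close> by one.
\<close>

section \<open>Additive energy\<close>

text \<open>One notion for two maps covers solutions written with sums, solutions written with
  differences, and the edges of a graph paired with their sums. A single Cauchy--Schwarz inequality
  over fibre sizes, \<open>coincidences_sq_le\<close>, then serves all three.\<close>

definition coincidences :: "('a \<Rightarrow> 'c) \<Rightarrow> 'a set \<Rightarrow> ('b \<Rightarrow> 'c) \<Rightarrow> 'b set \<Rightarrow> nat" where
  "coincidences f X g Y = card {(x, y) \<in> X \<times> Y. f x = g y}"

lemma coincidences_eq_sum:
  assumes "finite X" "finite Y" "finite Z" "f ` X \<subseteq> Z"
  shows "coincidences f X g Y = (\<Sum>z\<in>Z. card {x \<in> X. f x = z} * card {y \<in> Y. g y = z})"
proof -
  have "{(x, y) \<in> X \<times> Y. f x = g y} = (\<Union>z\<in>Z. {x \<in> X. f x = z} \<times> {y \<in> Y. g y = z})"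
    using assms(4) by auto
  then have "coincidences f X g Y = card (\<Union>z\<in>Z. {x \<in> X. f x = z} \<times> {y \<in> Y. g y = z})"
    by (simp add: coincidences_def)
  also have "\<dots> = (\<Sum>z\<in>Z. card ({x \<in> X. f x = z} \<times> {y \<in> Y. g y = z}))"
    using assms by (intro card_UN_disjoint) auto
  finally show ?thesis by (simp add: card_cartesian_product)
qed

lemma coincidences_sq_le:
  assumes "finite X" "finite Y"
  shows "(real (coincidences f X g Y))\<^sup>2 \<le> real (coincidences f X f X) * real (coincidences g Y g Y)"
proof -
  define Z where "Z = f ` X \<union> g ` Y"
  have Z: "finite Z" "f ` X \<subseteq> Z" "g ` Y \<subseteq> Z" using assms by (auto simp: Z_def)
  show ?thesis
    unfolding coincidences_eq_sum[OF assms Z(1,2)] coincidences_eq_sum[OF assms(1,1) Z(1,2)]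
      coincidences_eq_sum[OF assms(2,2) Z(1,3)]
    using Cauchy_Schwarz_ineq_sum[of "\<lambda>z. real (card {x \<in> X. f x = z})" "\<lambda>z. real (card {y \<in> Y. g y = z})" Z]
    by (simp add: power2_eq_square)
qed

definition sum_solutions :: "nat set \<Rightarrow> nat set \<Rightarrow> nat set \<Rightarrow> nat set \<Rightarrow> nat" where
  "sum_solutions A B C D = coincidences (\<lambda>(a, b). a + b) (A \<times> B) (\<lambda>(c, d). c + d) (C \<times> D)"

definition energy :: "nat set \<Rightarrow> nat" where
  "energy A = sum_solutions A A A A"

lemma sum_solutions_eq_card:
  "sum_solutions A B C D = card {((a, b), (c, d)). a \<in> A \<and> b \<in> B \<and> c \<in> C \<and> d \<in> D \<and> a + b = c + d}"
  unfolding sum_solutions_def coincidences_def by (rule arg_cong[of _ _ card]) auto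

lemma sum_solutions_sq_le:
  assumes "finite A" "finite B" "finite C" "finite D"
  shows "(real (sum_solutions A B C D))\<^sup>2 \<le> real (sum_solutions A B A B) * real (sum_solutions C D C D)"
  unfolding sum_solutions_def using assms by (intro coincidences_sq_le) auto

lemma sum_solutions_swap_left: "sum_solutions A B C D = sum_solutions B A C D"
  unfolding sum_solutions_eq_card
  by (rule bij_betw_same_card[of "\<lambda>((a, b), (c, d)). ((b, a), (c, d))"],
      rule bij_betw_byWitness[where f' = "\<lambda>((a, b), (c, d)). ((b, a), (c, d))"]) (auto simp: add.commute)

lemma sum_solutions_swap_right: "sum_solutions A B C D = sum_solutions A B D C"
  unfolding sum_solutions_eq_card
  by (rule bij_betw_same_card[of "\<lambda>((a, b), (c, d)). ((a, b), (d, c))"],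
      rule bij_betw_byWitness[where f' = "\<lambda>((a, b), (c, d)). ((a, b), (d, c))"]) (auto simp: add.commute)

lemma sum_solutions_swap_sides: "sum_solutions A B C D = sum_solutions C D A B"
  unfolding sum_solutions_eq_card
  by (rule bij_betw_same_card[of "\<lambda>(u, v). (v, u)"],
      rule bij_betw_byWitness[where f' = "\<lambda>(u, v). (v, u)"]) auto

text \<open>Rewriting the equation as \<open>a - c = d - b\<close> puts \<open>A\<close>,
  \<open>C\<close> on one side and \<open>B\<close>, \<open>D\<close> on the other. When
  \<open>A = C\<close> and \<open>B = D\<close>, Cauchy--Schwarz then separates the two sets into
  their energies. The differences are taken in the integers because subtraction on naturals
  truncates.\<close>

lemma sum_solutions_eq_differences:
  "sum_solutions A B C D =
    coincidences (\<lambda>(a, c). int a - int c) (A \<times> C) (\<lambda>(b, d). int d - int b) (B \<times> D)"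
  unfolding sum_solutions_eq_card coincidences_def
  by (rule bij_betw_same_card[of "\<lambda>((a, b), (c, d)). ((a, c), (b, d))"],
      rule bij_betw_byWitness[where f' = "\<lambda>((a, c), (b, d)). ((a, b), (c, d))"]) auto

lemma sum_solutions_sq_le_energy:
  assumes "finite A" "finite B"
  shows "(real (sum_solutions A B A B))\<^sup>2 \<le> real (energy A) * real (energy B)"
proof -
  \<comment> \<open>The two sides of \<open>a - c = d - b\<close> order their differences
    oppositely, so both orders are identified with the energy.\<close>
  have "coincidences (\<lambda>(a, c). int a - int c) (A \<times> A) (\<lambda>(a, c). int a - int c) (A \<times> A) = energy A" for A
    unfolding energy_def sum_solutions_eq_differences coincidences_def
    by (rule bij_betw_same_card[of "\<lambda>((a, c), (b, d)). ((a, c), (d, b))"],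
      rule bij_betw_byWitness[where f' = "\<lambda>((a, c), (b, d)). ((a, c), (d, b))"]) auto
  moreover have "coincidences (\<lambda>(a, c). int c - int a) (A \<times> A) (\<lambda>(a, c). int c - int a) (A \<times> A) = energy A" for A
    unfolding energy_def sum_solutions_eq_differences coincidences_def
    by (rule bij_betw_same_card[of "\<lambda>((a, c), (b, d)). ((c, a), (b, d))"],
      rule bij_betw_byWitness[where f' = "\<lambda>((a, c), (b, d)). ((c, a), (b, d))"]) auto
  ultimately show ?thesis
    unfolding sum_solutions_eq_differences[of A B A B]
    using coincidences_sq_le[of "A \<times> A" "B \<times> B" "\<lambda>(a, c). int a - int c" "\<lambda>(b, d). int d - int b"]
      assms by simp
qed

section \<open>Fibres of a p-adic valuation\<close>

text \<open>No valuation can be strictly smaller than the other three: a power of \<open>p\<close>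
  one higher would divide the other three terms, hence also the remaining one. So the minimum is
  attained at least twice.\<close>

lemma two_equal_multiplicities:
  fixes p :: nat
  assumes "prime p" "x1 > 0" "x2 > 0" "x3 > 0" "x4 > 0" and eq: "x1 + x2 = x3 + x4"
  defines "v \<equiv> multiplicity p"
  shows "v x1 = v x2 \<or> v x3 = v x4 \<or> v x1 = v x3 \<or> v x1 = v x4 \<or> v x2 = v x3 \<or> v x2 = v x4"
proof -
  have dvd: "p ^ Suc (v x) dvd y" if "v x < v y" for x y
    using that unfolding v_def by (intro multiplicity_dvd') auto
  have ndvd: "\<not> p ^ Suc (v x) dvd x" if "x > 0" for x
    using that assms(1) unfolding v_def
    by (subst power_dvd_iff_le_multiplicity) (auto simp: prime_gt_Suc_0_nat)
  have *: "\<not> (v a < v b \<and> v a < v c \<and> v a < v d)" if "a > 0" "a + b = c + d" for a b c d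
  proof
    assume "v a < v b \<and> v a < v c \<and> v a < v d"
    then have "p ^ Suc (v a) dvd b" "p ^ Suc (v a) dvd c + d" using dvd by auto
    then have "p ^ Suc (v a) dvd a" using that(2) by (metis dvd_add_left_iff)
    with ndvd that(1) show False by blast
  qed
  have "\<not> (v x1 < v x2 \<and> v x1 < v x3 \<and> v x1 < v x4)"
    "\<not> (v x2 < v x1 \<and> v x2 < v x3 \<and> v x2 < v x4)"
    "\<not> (v x3 < v x4 \<and> v x3 < v x1 \<and> v x3 < v x2)"
    "\<not> (v x4 < v x3 \<and> v x4 < v x1 \<and> v x4 < v x2)"
    using *[of x1 x2 x3 x4] *[of x2 x1 x3 x4] *[of x3 x4 x1 x2] *[of x4 x3 x1 x2] assms(2-6)
    by (simp_all add: add.commute)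
  then show ?thesis by (metis linorder_less_linear order_less_trans)
qed

text \<open>Solutions are sorted by the pair of unknowns with equal valuation, six possibilities,
  and by the common value \<open>j\<close>. Each class has at most
  \<open>sqrt (energy (F j)) * sqrt (energy A)\<close> members; summing and cancelling
  \<open>sqrt (energy A)\<close> gives the claim.\<close>

lemma sqrt_energy_le_sum_fibres:
  fixes p :: nat
  assumes "prime p" and fin: "finite A" and pos: "\<forall>a\<in>A. a > 0"
  defines "F \<equiv> \<lambda>j. {a \<in> A. multiplicity p a = j}"
  shows "sqrt (energy A) \<le> 6 * (\<Sum>j\<in>multiplicity p ` A. sqrt (energy (F j)))"
proof -
  let ?J = "multiplicity p ` A"
  let ?Q = "\<lambda>A B C D. {((a, b), (c, d)). a \<in> A \<and> b \<in> B \<and> c \<in> C \<and> d \<in> D \<and> a + b = c + (d::nat)}"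
  have finF: "finite (F j)" for j using fin by (auto simp: F_def)
  have finQ: "finite (?Q A B C D)" if "finite A" "finite B" "finite C" "finite D" for A B C D
    by (rule finite_subset[of _ "(A \<times> B) \<times> (C \<times> D)"]) (use that in auto)
  have split: "?Q A A A A \<subseteq> (\<Union>j\<in>?J. ?Q (F j) (F j) A A \<union> ?Q A A (F j) (F j) \<union> ?Q (F j) A (F j) A
      \<union> ?Q (F j) A A (F j) \<union> ?Q A (F j) (F j) A \<union> ?Q A (F j) A (F j))" (is "_ \<subseteq> (\<Union>j\<in>_. ?U j)")
  proof clarify
    fix a b c d assume in_A: "a \<in> A" "b \<in> A" "c \<in> A" "d \<in> A" and eq: "a + b = c + d"
    have "a > 0" "b > 0" "c > 0" "d > 0" using in_A pos by auto
    from two_equal_multiplicities[OF assms(1) this eq]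
    show "((a, b), (c, d)) \<in> (\<Union>j\<in>?J. ?U j)"
      using in_A eq unfolding F_def by (elim disjE) auto
  qed
  \<comment> \<open>The first bound is for a pair on the same side of the equation and uses
    Cauchy--Schwarz for sums; the second is for a pair on opposite sides and uses it for
    differences.\<close>
  have sides: "sum_solutions B B A A \<le> sqrt (energy B) * sqrt (energy A)"
    "sum_solutions B A B A \<le> sqrt (energy B) * sqrt (energy A)" if "finite B" for B
    using sum_solutions_sq_le[OF that that fin fin] sum_solutions_sq_le_energy[OF that fin]
    by (auto simp: energy_def real_le_rsqrt simp flip: real_sqrt_mult)
  have Ubound: "card (?U j) \<le> 6 * (sqrt (energy (F j)) * sqrt (energy A))" for j
  proof -
    let ?s = sum_solutions
    have "card (?U j) \<le> ?s (F j) (F j) A A + ?s A A (F j) (F j) + ?s (F j) A (F j) A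
        + ?s (F j) A A (F j) + ?s A (F j) (F j) A + ?s A (F j) A (F j)"
      unfolding sum_solutions_eq_card
      by (intro order.trans[OF card_Un_le] add_mono order.refl)
    also have "\<dots> = 2 * ?s (F j) (F j) A A + 4 * ?s (F j) A (F j) A"
      using sum_solutions_swap_sides[of A A "F j" "F j"] sum_solutions_swap_right[of "F j" A A "F j"]
        sum_solutions_swap_left[of A "F j" "F j" A] sum_solutions_swap_left[of A "F j" A "F j"]
      by simp
    finally show ?thesis using sides[OF finF[of j]] by linarith
  qed
  have "real (energy A) \<le> real (card (\<Union>j\<in>?J. ?U j))"
    unfolding energy_def sum_solutions_eq_card of_nat_le_iff
    by (rule card_mono[OF _ split]) (intro finite_UN_I finite_UnI finQ finite_imageI fin finF)
  also have "\<dots> \<le> (\<Sum>j\<in>?J. real (card (?U j)))"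
    using card_UN_le[of ?J ?U] fin by (simp flip: of_nat_sum)
  also have "\<dots> \<le> (\<Sum>j\<in>?J. 6 * (sqrt (energy (F j)) * sqrt (energy A)))"
    by (intro sum_mono Ubound)
  also have "\<dots> = (6 * (\<Sum>j\<in>?J. sqrt (energy (F j)))) * sqrt (energy A)"
    by (simp add: sum_distrib_left sum_distrib_right mult.assoc)
  finally have *: "sqrt (energy A) * sqrt (energy A) \<le> \<dots>" by simp
  show ?thesis
  proof (cases "energy A = 0")
    case False
    then show ?thesis using mult_right_le_imp_le[OF *] by simp
  qed (auto intro!: sum_nonneg)
qed

section \<open>Valuation vectors, rational spans and energy\<close>

text \<open>Integer values make the vectors elements of an abelian group under pointwise operations.
  Nonprime coordinates are 0 because multiplicities add under products only at primes in
  general.\<close>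

definition valuation :: "nat \<Rightarrow> nat \<Rightarrow> int" where
  "valuation a p = (if prime p then int (multiplicity p a) else 0)"

lemma valuation_mult:
  assumes "a > 0" "b > 0"
  shows "valuation (a * b) = valuation a + valuation b"
  using assms by (auto simp: valuation_def fun_eq_iff prime_elem_multiplicity_mult_distrib)

lemma valuation_inject:
  assumes "a > 0" "b > 0" "valuation a = valuation b"
  shows "a = b"
proof (rule multiplicity_eq_nat)
  fix p :: nat assume "prime p"
  then show "multiplicity p a = multiplicity p b"
    using fun_cong[OF assms(3), of p] by (simp add: valuation_def)
qed (use assms in auto)

text \<open>The integer vectors in the rational span of \<open>x 0, \<dots>, x (d - 1)\<close>.\<close>

definition qspan :: "(nat \<Rightarrow> nat \<Rightarrow> int) \<Rightarrow> nat \<Rightarrow> (nat \<Rightarrow> int) set" where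
  "qspan x d = {y. \<exists>m k. m \<noteq> 0 \<and> (\<forall>p. m * y p = (\<Sum>i<d. k i * x i p))}"

lemma qspanI:
  assumes "m \<noteq> 0" "\<And>p. m * y p = (\<Sum>i<d. k i * x i p)"
  shows "y \<in> qspan x d"
  unfolding qspan_def using assms by (intro CollectI exI[of _ m] exI[of _ k]) simp

lemma qspan_zero: "0 \<in> qspan x d"
  by (rule qspanI[where m = 1 and k = "\<lambda>_. 0"]) simp_all

lemma qspan_diff:
  assumes "y \<in> qspan x d" "z \<in> qspan x d"
  shows "y - z \<in> qspan x d"
proof -
  from assms obtain m k n l where "m \<noteq> 0" "n \<noteq> 0"
    and mk: "\<And>p. m * y p = (\<Sum>i<d. k i * x i p)" and nl: "\<And>p. n * z p = (\<Sum>i<d. l i * x i p)"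
    unfolding qspan_def by blast
  have "m * n * (y - z) p = (\<Sum>i<d. (n * k i - m * l i) * x i p)" for p
  proof -
    have "m * n * (y - z) p = n * (m * y p) - m * (n * z p)" by (simp add: algebra_simps)
    also have "\<dots> = (\<Sum>i<d. (n * k i - m * l i) * x i p)"
      unfolding mk nl sum_distrib_left sum_subtractf[symmetric] by (simp add: left_diff_distrib mult.assoc)
    finally show ?thesis .
  qed
  moreover have "m * n \<noteq> 0" using \<open>m \<noteq> 0\<close> \<open>n \<noteq> 0\<close> by simp
  ultimately show ?thesis by (rule qspanI[rotated])
qed

text \<open>One step of Gaussian elimination, with pivot \<open>x d p\<close>.\<close>

lemma qspan_eliminate:
  assumes "y \<in> qspan x (Suc d)" "x d p \<noteq> 0" "y p = 0"
  shows "y \<in> qspan (\<lambda>i q. x d p * x i q - x i p * x d q) d"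
proof -
  from assms(1) obtain m k where "m \<noteq> 0" and mk: "\<And>q. m * y q = (\<Sum>i<Suc d. k i * x i q)"
    unfolding qspan_def by blast
  have p0: "(\<Sum>i<d. k i * x i p) = - (k d * x d p)" using mk[of p] assms(3) by simp
  have "(x d p * m) * y q = (\<Sum>i<d. k i * (x d p * x i q - x i p * x d q))" for q
  proof -
    have "(\<Sum>i<d. k i * (x d p * x i q - x i p * x d q))
        = x d p * (\<Sum>i<d. k i * x i q) - (\<Sum>i<d. k i * x i p) * x d q"
      unfolding sum_distrib_left sum_distrib_right sum_subtractf[symmetric]
      by (intro sum.cong) (simp_all add: algebra_simps)
    also have "\<dots> = x d p * (m * y q)" unfolding p0 mk by (simp add: algebra_simps)
    finally show ?thesis by simp
  qed
  moreover have "x d p * m \<noteq> 0" using assms(2) \<open>m \<noteq> 0\<close> by simp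
  ultimately show ?thesis by (rule qspanI[rotated])
qed

lemma energy_le_of_card_le_1:
  assumes "card A \<le> 1" "finite A"
  shows "energy A \<le> card A"
proof (cases "A = {}")
  case True
  then show ?thesis by (simp add: energy_def sum_solutions_def coincidences_def)
next
  case False
  with assms have "card A = 1" using card_gt_0_iff[of A] by linarith
  then obtain a where "A = {a}" by (auto simp: card_1_singleton_iff)
  moreover have "{((x, b), (c, d)). x \<in> {a} \<and> b \<in> {a} \<and> c \<in> {a} \<and> d \<in> {a} \<and> x + b = c + d} = {((a, a), (a, a))}"
    by auto
  ultimately show ?thesis by (simp add: energy_def sum_solutions_eq_card)
qed

text \<open>Induction on the number of generators. A zero last generator is dropped. Otherwise it is
  nonzero at some \<open>p\<close>; differences within a fibre of the valuation at \<open>p\<close>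
  vanish there, so elimination removes one generator at the cost of a factor 6. The square root is
  what is bounded because an estimate linear in the cardinality adds up over the fibres without
  loss.\<close>

lemma sqrt_energy_le_of_qspan:
  assumes "finite A" "\<forall>a\<in>A. a > 0"
    and "\<And>a b. a \<in> A \<Longrightarrow> b \<in> A \<Longrightarrow> valuation a - valuation b \<in> qspan x d"
  shows "sqrt (energy A) \<le> 6 ^ d * real (card A)"
  using assms
proof (induction d arbitrary: x A)
  case 0
  \<comment> \<open>Without generators every difference of valuations is zero, so \<open>A\<close>
    has at most one element.\<close>
  have "a = b" if "a \<in> A" "b \<in> A" for a b
  proof (rule valuation_inject)
    have "valuation a - valuation b \<in> qspan x 0" using 0 that by blast
    then show "valuation a = valuation b" by (auto simp: qspan_def fun_eq_iff)
  qed (use 0 that in auto)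
  then have "card A \<le> 1" using 0(1) by (simp add: card_le_Suc0_iff_eq)
  then have le: "energy A \<le> card A" using energy_le_of_card_le_1 0(1) by blast
  have "sqrt (energy A) \<le> sqrt (card A)" using le by simp
  also have "\<dots> = card A" using \<open>card A \<le> 1\<close> by (cases "card A") auto
  finally show ?case by simp
next
  case (Suc d)
  show ?case
  proof (cases "\<forall>p. x d p = 0")
    case True
    have "valuation a - valuation b \<in> qspan x d" if "a \<in> A" "b \<in> A" for a b
      using Suc.prems(3)[OF that] True by (simp add: qspan_def)
    then have "sqrt (energy A) \<le> 6 ^ d * real (card A)" by (rule Suc.IH[OF Suc.prems(1,2)])
    also have "\<dots> \<le> 6 ^ Suc d * real (card A)" by simp
    finally show ?thesis .
  next
    case False
    then obtain p where p: "x d p \<noteq> 0" by blast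
    let ?x = "\<lambda>i q. x d p * x i q - x i p * x d q"
    have fibre: "valuation a - valuation b \<in> qspan ?x d"
      if "a \<in> A" "b \<in> A" "valuation a p = valuation b p" for a b
    proof (rule qspan_eliminate[of _ x])
      show "valuation a - valuation b \<in> qspan x (Suc d)" by (rule Suc.prems(3)[OF that(1,2)])
    qed (use p that(3) in simp_all)
    show ?thesis
    proof (cases "prime p")
      case False
      \<comment> \<open>At a nonprime \<open>p\<close> every valuation vector is 0, so all of
        \<open>A\<close> is one fibre and no splitting takes place.\<close>
      have "valuation a - valuation b \<in> qspan ?x d" if "a \<in> A" "b \<in> A" for a b
        by (rule fibre) (use that False in \<open>simp_all add: valuation_def\<close>)
      then have "sqrt (energy A) \<le> 6 ^ d * real (card A)" by (rule Suc.IH[OF Suc.prems(1,2)])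
      also have "\<dots> \<le> 6 ^ Suc d * real (card A)" by simp
      finally show ?thesis .
    next
      case True
      let ?F = "\<lambda>j. {a \<in> A. multiplicity p a = j}"
      let ?J = "multiplicity p ` A"
      have "sqrt (energy (?F j)) \<le> 6 ^ d * real (card (?F j))" for j
      proof (rule Suc.IH)
        show "valuation a - valuation b \<in> qspan ?x d" if "a \<in> ?F j" "b \<in> ?F j" for a b
          by (rule fibre) (use that in \<open>simp_all add: valuation_def\<close>)
      qed (use Suc.prems(1,2) in auto)
      then have "(\<Sum>j\<in>?J. sqrt (energy (?F j))) \<le> (\<Sum>j\<in>?J. 6 ^ d * real (card (?F j)))"
        by (intro sum_mono)
      also have "\<dots> = 6 ^ d * real (\<Sum>j\<in>?J. card (?F j))" by (simp add: sum_distrib_left)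
      also have "(\<Sum>j\<in>?J. card (?F j)) = card (\<Union>j\<in>?J. ?F j)"
        using Suc.prems(1) by (subst card_UN_disjoint) auto
      also have "(\<Union>j\<in>?J. ?F j) = A" by auto
      finally show ?thesis
        using sqrt_energy_le_sum_fibres[OF True Suc.prems(1,2)] by simp
    qed
  qed
qed

section \<open>Small sums along a dense graph\<close>

text \<open>Double counting: \<open>g y\<close> embeds the index set \<open>I y\<close> into the
  fibre of \<open>h\<close> over \<open>y\<close>, and distinct fibres are disjoint subsets of
  \<open>R\<close>. All later counts of representations take this form.\<close>

lemma card_mult_le_of_representations:
  fixes t :: real
  assumes "finite R" and "\<And>y. y \<in> Y \<Longrightarrow> t \<le> real (card (I y))"
    and "\<And>y. y \<in> Y \<Longrightarrow> inj_on (g y) (I y)"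
    and "\<And>y i. y \<in> Y \<Longrightarrow> i \<in> I y \<Longrightarrow> g y i \<in> R \<and> h (g y i) = y"
  shows "t * real (card Y) \<le> real (card R)"
proof (cases "finite Y")
  case True
  have fibre: "t \<le> real (card {r \<in> R. h r = y})" if "y \<in> Y" for y
  proof -
    have "card (I y) = card (g y ` I y)" using assms(3)[OF that] by (simp add: card_image)
    also have "\<dots> \<le> card {r \<in> R. h r = y}"
      using assms(4)[OF that] assms(1) by (intro card_mono) auto
    finally show ?thesis using assms(2)[OF that] by linarith
  qed
  have "t * real (card Y) = (\<Sum>y\<in>Y. t)" by simp
  also have "\<dots> \<le> (\<Sum>y\<in>Y. real (card {r \<in> R. h r = y}))" using fibre by (intro sum_mono)
  also have "\<dots> = real (card (\<Union>y\<in>Y. {r \<in> R. h r = y}))"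
    using True assms(1) by (subst card_UN_disjoint) auto
  also have "\<dots> \<le> real (card R)"
    using assms(1) by (intro of_nat_mono card_mono) auto
  finally show ?thesis .
qed simp

section \<open>Dependent random choice and the Balog--Szemeredi--Gowers theorem\<close>

definition codegree :: "('a \<times> 'b) set \<Rightarrow> 'a \<Rightarrow> 'a \<Rightarrow> nat" where
  "codegree G a a' = card {b. (a, b) \<in> G \<and> (a', b) \<in> G}"

text \<open>\<open>N\<close> is the neighbourhood of a suitable \<open>b\<close>. Averaged over
  \<open>b\<close>, neighbourhoods are large by Cauchy--Schwarz, while a pair of small codegree
  lies, by definition, in few of them.\<close>

lemma dependent_random_choice:
  fixes \<delta> n :: real
  assumes fin: "finite A" "finite B" and G: "G \<subseteq> A \<times> B"
    and cards: "real (card A) \<le> n" "real (card B) \<le> n" and pos: "n > 0" "\<delta> > 0"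
    and dense: "real (card G) \<ge> \<delta> * n\<^sup>2"
  shows "\<exists>N\<subseteq>A. real (card N) \<ge> \<delta> * n / 2 \<and>
    16 * real (card {(a, a') \<in> N \<times> N. real (codegree G a a') < \<delta>\<^sup>2 * n / 32}) \<le> (real (card N))\<^sup>2"
proof -
  define N where "N b = {a. (a, b) \<in> G}" for b
  define bad where "bad a a' \<longleftrightarrow> real (codegree G a a') < \<delta>\<^sup>2 * n / 32" for a a'
  define Z where "Z b = {(a, a') \<in> N b \<times> N b. bad a a'}" for b
  have NA: "N b \<subseteq> A" for b using G by (auto simp: N_def)
  have finN: "finite (N b)" for b using NA fin(1) finite_subset by blast
  have finZ: "finite (Z b)" for b by (rule finite_subset[of _ "N b \<times> N b"]) (auto simp: Z_def finN)
  have "card G = card (\<Union>b\<in>B. N b \<times> {b})"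
    using G by (intro arg_cong[of _ _ card]) (auto simp: N_def)
  also have "\<dots> = (\<Sum>b\<in>B. card (N b \<times> {b}))"
    using fin finN by (intro card_UN_disjoint) auto
  finally have cardG: "real (card G) = (\<Sum>b\<in>B. real (card (N b)))" by (simp add: card_cartesian_product)
  have "(\<delta> * n\<^sup>2)\<^sup>2 \<le> (real (card G))\<^sup>2" using dense pos by (intro power_mono) auto
  also have "\<dots> \<le> real (card B) * (\<Sum>b\<in>B. (real (card (N b)))\<^sup>2)"
    using Cauchy_Schwarz_ineq_sum[of "\<lambda>_. 1" "\<lambda>b. real (card (N b))" B] cardG by simp
  also have "\<dots> \<le> n * (\<Sum>b\<in>B. (real (card (N b)))\<^sup>2)"
    using cards by (intro mult_right_mono sum_nonneg) auto
  finally have "n * (\<delta>\<^sup>2 * n ^ 3) \<le> n * (\<Sum>b\<in>B. (real (card (N b)))\<^sup>2)"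
    by (simp add: power2_eq_square power3_eq_cube algebra_simps)
  then have squares: "\<delta>\<^sup>2 * n ^ 3 \<le> (\<Sum>b\<in>B. (real (card (N b)))\<^sup>2)" using pos by simp
  define Y where "Y = {(a, a') \<in> A \<times> A. bad a a'}"
  have finY: "finite Y" by (rule finite_subset[of _ "A \<times> A"]) (auto simp: fin Y_def)
  have "(\<Sum>b\<in>B. real (card (Z b))) = (\<Sum>b\<in>B. \<Sum>(a, a')\<in>Y. of_bool ((a, b) \<in> G \<and> (a', b) \<in> G))"
  proof (rule sum.cong[OF refl])
    fix b
    have "(\<Sum>(a, a')\<in>Y. of_bool ((a, b) \<in> G \<and> (a', b) \<in> G))
      = (\<Sum>q\<in>Y. of_bool (q \<in> Z b) :: real)"
      by (intro sum.cong) (auto simp: Z_def N_def Y_def)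
    also have "\<dots> = real (card (Y \<inter> Z b))"
      by (subst sum_of_bool_eq) (auto simp: finY Int_def)
    also have "Y \<inter> Z b = Z b" using NA by (auto simp: Z_def Y_def)
    finally show "real (card (Z b)) = (\<Sum>(a, a')\<in>Y. of_bool ((a, b) \<in> G \<and> (a', b) \<in> G))"
      by simp
  qed
  also have "\<dots> = (\<Sum>(a, a')\<in>Y. \<Sum>b\<in>B. of_bool ((a, b) \<in> G \<and> (a', b) \<in> G))"
    by (subst sum.swap) (simp add: case_prod_unfold)
  also have "\<dots> \<le> (\<Sum>(a, a')\<in>Y. \<delta>\<^sup>2 * n / 32)"
  proof (rule sum_mono, clarify)
    fix a a' assume "(a, a') \<in> Y"
    then have "bad a a'" by (simp add: Y_def)
    have "(\<Sum>b\<in>B. of_bool ((a, b) \<in> G \<and> (a', b) \<in> G)) = real (card (B \<inter> {b. (a, b) \<in> G \<and> (a', b) \<in> G}))"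
      by (subst sum_of_bool_eq) (auto simp: fin)
    also have "B \<inter> {b. (a, b) \<in> G \<and> (a', b) \<in> G} = {b. (a, b) \<in> G \<and> (a', b) \<in> G}" using G by auto
    finally show "(\<Sum>b\<in>B. of_bool ((a, b) \<in> G \<and> (a', b) \<in> G)) \<le> \<delta>\<^sup>2 * n / 32"
      using \<open>bad a a'\<close> by (simp add: bad_def codegree_def)
  qed
  also have "\<dots> = real (card Y) * (\<delta>\<^sup>2 * n / 32)" by (simp add: case_prod_unfold)
  also have "\<dots> \<le> n\<^sup>2 * (\<delta>\<^sup>2 * n / 32)"
  proof (rule mult_right_mono)
    have "card Y \<le> card (A \<times> A)" using fin by (intro card_mono) (auto simp: Y_def)
    then have "real (card Y) \<le> real (card A) * real (card A)"
      by (simp add: card_cartesian_product flip: of_nat_mult)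
    also have "\<dots> \<le> n * n" using cards pos by (intro mult_mono) auto
    finally show "real (card Y) \<le> n\<^sup>2" by (simp add: power2_eq_square)
  qed (use pos in auto)
  \<comment> \<open>The codegree threshold carries 1/32 so that 16 times the bad pairs use up only
    half of the lower bound \<open>squares\<close>.\<close>
  finally have bads: "16 * (\<Sum>b\<in>B. real (card (Z b))) \<le> \<delta>\<^sup>2 * n ^ 3 / 2"
    by (simp add: power2_eq_square power3_eq_cube algebra_simps)
  \<comment> \<open>Averaging this one difference yields both conclusions for the same
    \<open>b\<close>: the neighbourhood is large, and its bad pairs are few relative to its
    square.\<close>
  have "\<exists>b\<in>B. (real (card (N b)))\<^sup>2 - 16 * real (card (Z b)) \<ge> \<delta>\<^sup>2 * n\<^sup>2 / 2"
  proof (rule ccontr)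
    assume "\<not> ?thesis"
    then have less: "(real (card (N b)))\<^sup>2 - 16 * real (card (Z b)) < \<delta>\<^sup>2 * n\<^sup>2 / 2" if "b \<in> B" for b
      using that by force
    have "\<delta>\<^sup>2 * n ^ 3 > 0" using pos by simp
    then have "B \<noteq> {}" using squares by auto
    then have "(\<Sum>b\<in>B. (real (card (N b)))\<^sup>2 - 16 * real (card (Z b))) < (\<Sum>b\<in>B. \<delta>\<^sup>2 * n\<^sup>2 / 2)"
      using fin less by (intro sum_strict_mono) auto
    also have "\<dots> = real (card B) * (\<delta>\<^sup>2 * n\<^sup>2 / 2)" by simp
    also have "\<dots> \<le> n * (\<delta>\<^sup>2 * n\<^sup>2 / 2)" using cards by (intro mult_right_mono) auto
    also have "\<dots> = \<delta>\<^sup>2 * n ^ 3 / 2" by (simp add: power2_eq_square power3_eq_cube)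
    finally show False
      using squares bads by (simp only: sum_subtractf sum_distrib_left[symmetric])
  qed
  then obtain b where "b \<in> B" and b: "(real (card (N b)))\<^sup>2 - 16 * real (card (Z b)) \<ge> \<delta>\<^sup>2 * n\<^sup>2 / 2" by blast
  have "(\<delta> * n / 2)\<^sup>2 \<le> \<delta>\<^sup>2 * n\<^sup>2 / 2" by (simp add: power_mult_distrib power_divide)
  also have "\<dots> \<le> (real (card (N b)))\<^sup>2" using b by linarith
  finally have "\<delta> * n / 2 \<le> real (card (N b))" by (rule power2_le_imp_le) simp
  moreover have "16 * real (card (Z b)) \<le> (real (card (N b)))\<^sup>2"
    using b zero_le_power2[of "\<delta> * n"] unfolding power_mult_distrib by linarith
  ultimately show ?thesis using NA[of b] unfolding Z_def bad_def by (intro exI[of _ "N b"] conjI)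
qed

text \<open>Keep the elements with at most a quarter of \<open>N\<close> as bad partners. The factor
  16 forces all but a quarter of \<open>N\<close> to survive, and two survivors together exclude at
  most half of \<open>N\<close>.\<close>

lemma many_common_good:
  assumes fin: "finite N" and few: "16 * real (card {(a, a') \<in> N \<times> N. bad a a'}) \<le> (real (card N))\<^sup>2"
  shows "\<exists>M\<subseteq>N. real (card M) \<ge> real (card N) / 2 \<and>
    (\<forall>a\<in>M. \<forall>b\<in>M. real (card {u \<in> N. \<not> bad a u \<and> \<not> bad b u}) \<ge> real (card N) / 2)"
proof -
  define M where "M = {a \<in> N. real (card {u \<in> N. bad a u}) \<le> real (card N) / 4}"
  have "real (card N) / 4 * real (card (N - M)) \<le> real (card {(a, a') \<in> N \<times> N. bad a a'})"
  proof (rule card_mult_le_of_representations[where h = fst and g = Pair and I = "\<lambda>a. {u \<in> N. bad a u}"])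
    show "finite {(a, a') \<in> N \<times> N. bad a a'}" by (rule finite_subset[of _ "N \<times> N"]) (auto simp: fin)
  qed (auto simp: M_def inj_on_def)
  then have "real (card N) * real (card (N - M)) \<le> real (card N) * (real (card N) / 4)"
    using few by (simp add: power2_eq_square)
  then have "real (card (N - M)) \<le> real (card N) / 4"
    by (cases "card N = 0") (use fin in auto)
  moreover have "card (N - M) = card N - card M" "card M \<le> card N"
    using fin by (auto simp: M_def intro!: card_Diff_subset card_mono)
  ultimately have "real (card M) \<ge> real (card N) / 2" by (simp add: of_nat_diff)
  moreover have "real (card {u \<in> N. \<not> bad a u \<and> \<not> bad b u}) \<ge> real (card N) / 2" if "a \<in> M" "b \<in> M" for a b
  proof -
    let ?U = "{u \<in> N. \<not> bad a u \<and> \<not> bad b u}"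
    have "N = ?U \<union> ({u \<in> N. bad a u} \<union> {u \<in> N. bad b u})" by auto
    then have "card N \<le> card ?U + card ({u \<in> N. bad a u} \<union> {u \<in> N. bad b u})" by (metis card_Un_le)
    also have "\<dots> \<le> card ?U + (card {u \<in> N. bad a u} + card {u \<in> N. bad b u})"
      by (intro add_left_mono card_Un_le)
    finally show ?thesis using that unfolding M_def by force
  qed
  ultimately show ?thesis by (intro exI[of _ M]) (auto simp: M_def)
qed

definition difference_set :: "'a::minus set \<Rightarrow> 'a set" where
  "difference_set M = (\<lambda>(a, b). a - b) ` (M \<times> M)"

lemma finite_difference_set: "finite M \<Longrightarrow> finite (difference_set M)"
  by (simp add: difference_set_def)

lemma restricted_sumset_eq_image: "restricted_sumset G = (\<lambda>(a, b). a + b) ` G"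
  by (auto simp: restricted_sumset_def image_iff Bex_def split: prod.splits)

text \<open>A good difference is \<open>a - a' = (a + b) - (a' + b)\<close> for many common
  neighbours \<open>b\<close>, so the set \<open>D\<close> of good differences is small. Any two
  elements of \<open>M\<close> have many common good partners \<open>u\<close>, and
  \<open>a - b = (a - u) - (b - u)\<close> gives many representations by two elements of
  \<open>D\<close>.\<close>

lemma balog_szemeredi_gowers_differences:
  fixes A B :: "'a::ab_group_add set" and \<delta> c n :: real
  assumes fin: "finite A" "finite B" and G: "G \<subseteq> A \<times> B"
    and cards: "real (card A) \<le> n" "real (card B) \<le> n" and pos: "n > 0" "\<delta> > 0"
    and dense: "real (card G) \<ge> \<delta> * n\<^sup>2" and small: "real (card (restricted_sumset G)) \<le> c * n"
  shows "\<exists>M\<subseteq>A. real (card M) \<ge> \<delta> * n / 4 \<and> real (card (difference_set M)) \<le> 4096 * c ^ 4 / \<delta> ^ 5 * n"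
proof -
  let ?S = "restricted_sumset G"
  define bad where "bad a a' \<longleftrightarrow> real (codegree G a a') < \<delta>\<^sup>2 * n / 32" for a a'
  obtain N where N: "N \<subseteq> A" "real (card N) \<ge> \<delta> * n / 2"
    "16 * real (card {(a, a') \<in> N \<times> N. bad a a'}) \<le> (real (card N))\<^sup>2"
    using dependent_random_choice[OF fin G cards pos dense] unfolding bad_def by blast
  have finN: "finite N" using N(1) fin(1) finite_subset by blast
  obtain M where M: "M \<subseteq> N" "real (card M) \<ge> real (card N) / 2"
    and common: "\<And>a b. a \<in> M \<Longrightarrow> b \<in> M \<Longrightarrow> real (card {u \<in> N. \<not> bad a u \<and> \<not> bad b u}) \<ge> real (card N) / 2"
    using many_common_good[OF finN N(3)] by blast
  have finS: "finite ?S"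
    unfolding restricted_sumset_eq_image
    by (rule finite_imageI, rule finite_subset[OF G]) (simp add: fin)
  define D where "D = (\<lambda>(a, a'). a - a') ` {(a, a') \<in> A \<times> A. \<not> bad a a'}"
  have finD: "finite D" unfolding D_def
    by (rule finite_imageI, rule finite_subset[of _ "A \<times> A"]) (auto simp: fin)
  have DI: "a - a' \<in> D" if "a \<in> A" "a' \<in> A" "\<not> bad a a'" for a a'
    using that unfolding D_def by force
  \<comment> \<open>One pair is fixed for each difference, so that the index set of its
    representations depends on \<open>y\<close> alone; the same is done for
    \<open>difference_set M\<close> below.\<close>
  have "\<forall>y\<in>D. \<exists>q. \<not> bad (fst q) (snd q) \<and> y = fst q - snd q"
    by (auto simp: D_def)
  from bchoice[OF this] obtain r where r: "\<And>y. y \<in> D \<Longrightarrow> \<not> bad (fst (r y)) (snd (r y))"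
    "\<And>y. y \<in> D \<Longrightarrow> fst (r y) - snd (r y) = y" by metis
  have "(\<delta>\<^sup>2 * n / 32) * real (card D) \<le> real (card (?S \<times> ?S))"
  proof (rule card_mult_le_of_representations[where h = "\<lambda>(s, t). s - t"
        and I = "\<lambda>y. {b. (fst (r y), b) \<in> G \<and> (snd (r y), b) \<in> G}" and g = "\<lambda>y b. (fst (r y) + b, snd (r y) + b)"])
    show "finite (?S \<times> ?S)" using finS by simp
  next
    fix y assume "y \<in> D"
    then show "\<delta>\<^sup>2 * n / 32 \<le> real (card {b. (fst (r y), b) \<in> G \<and> (snd (r y), b) \<in> G})"
      using r(1)[of y] by (simp add: bad_def codegree_def)
  next
    fix y b assume "y \<in> D" and b: "b \<in> {b. (fst (r y), b) \<in> G \<and> (snd (r y), b) \<in> G}"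
    then show "(fst (r y) + b, snd (r y) + b) \<in> ?S \<times> ?S \<and>
        (case (fst (r y) + b, snd (r y) + b) of (s, t) \<Rightarrow> s - t) = y"
      using r(2)[of y] by (auto simp: restricted_sumset_def)
  qed (auto simp: inj_on_def)
  also have "\<dots> = (real (card ?S))\<^sup>2" by (simp add: card_cartesian_product power2_eq_square)
  also have "\<dots> \<le> (c * n)\<^sup>2" using small by (intro power_mono) auto
  finally have "real (card D) * (\<delta>\<^sup>2 * n) \<le> 32 * c\<^sup>2 * n * n" by (simp add: power2_eq_square algebra_simps)
  then have cD: "real (card D) * \<delta>\<^sup>2 \<le> 32 * c\<^sup>2 * n" using pos by simp
  have "\<forall>y\<in>difference_set M. \<exists>q. fst q \<in> M \<and> snd q \<in> M \<and> y = fst q - snd q"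
    by (auto simp: difference_set_def)
  from bchoice[OF this] obtain q where q: "\<And>y. y \<in> difference_set M \<Longrightarrow> fst (q y) \<in> M"
    "\<And>y. y \<in> difference_set M \<Longrightarrow> snd (q y) \<in> M"
    "\<And>y. y \<in> difference_set M \<Longrightarrow> fst (q y) - snd (q y) = y" by metis
  have "(real (card N) / 2) * real (card (difference_set M)) \<le> real (card (D \<times> D))"
  proof (rule card_mult_le_of_representations[where h = "\<lambda>(s, t). s - t"
        and I = "\<lambda>y. {u \<in> N. \<not> bad (fst (q y)) u \<and> \<not> bad (snd (q y)) u}"
        and g = "\<lambda>y u. (fst (q y) - u, snd (q y) - u)"])
    show "finite (D \<times> D)" using finD by simp
  next
    fix y assume "y \<in> difference_set M"
    then show "real (card N) / 2 \<le> real (card {u \<in> N. \<not> bad (fst (q y)) u \<and> \<not> bad (snd (q y)) u})"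
      using common q(1,2) by blast
  next
    fix y u assume y: "y \<in> difference_set M" and u: "u \<in> {u \<in> N. \<not> bad (fst (q y)) u \<and> \<not> bad (snd (q y)) u}"
    have "fst (q y) - u \<in> D" "snd (q y) - u \<in> D"
      using q(1,2)[OF y] u M(1) N(1) by (auto intro!: DI)
    then show "(fst (q y) - u, snd (q y) - u) \<in> D \<times> D \<and>
        (case (fst (q y) - u, snd (q y) - u) of (s, t) \<Rightarrow> s - t) = y"
      using q(3)[OF y] by simp
  qed (auto simp: inj_on_def)
  also have "\<dots> = (real (card D))\<^sup>2" by (simp add: card_cartesian_product power2_eq_square)
  finally have "(\<delta> * n / 4) * real (card (difference_set M)) \<le> (real (card D))\<^sup>2"
    using mult_right_mono[of "\<delta> * n / 4" "real (card N) / 2" "real (card (difference_set M))"] N(2) by simp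
  \<comment> \<open>The factor \<open>\<delta> ^ 4\<close> lets the bound \<open>cD\<close> enter
    squared; 4096 is 4 times the square of 32.\<close>
  then have "\<delta> ^ 4 * ((\<delta> * n / 4) * real (card (difference_set M))) \<le> \<delta> ^ 4 * (real (card D))\<^sup>2"
    using pos by (intro mult_left_mono) auto
  also have "\<dots> = (real (card D) * \<delta>\<^sup>2)\<^sup>2" by (simp add: power2_eq_square power4_eq_xxxx algebra_simps)
  also have "\<dots> \<le> (32 * c\<^sup>2 * n)\<^sup>2" using cD by (intro power_mono) auto
  also have "\<dots> = 1024 * c ^ 4 * n * n" by (simp add: power2_eq_square power4_eq_xxxx)
  finally have "n * (real (card (difference_set M)) * \<delta> ^ 5) \<le> n * (4096 * c ^ 4 * n)"
    by (simp add: algebra_simps eval_nat_numeral)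
  then have "real (card (difference_set M)) * \<delta> ^ 5 \<le> 4096 * c ^ 4 * n" using pos by simp
  then have "real (card (difference_set M)) \<le> 4096 * c ^ 4 / \<delta> ^ 5 * n" using pos by (simp add: field_simps)
  moreover have "real (card M) \<ge> \<delta> * n / 4" using M(2) N(2) by linarith
  ultimately show ?thesis using M(1) N(1) by blast
qed

section \<open>Ruzsa covering and absorption of translates\<close>

text \<open>\<open>X\<close> is a maximal subset of \<open>W\<close> whose translates of
  \<open>P\<close> are pairwise disjoint, built greedily. Disjointness gives the bound on
  \<open>card X\<close>; a rejected \<open>w\<close> has a translate meeting an earlier one.\<close>

lemma ruzsa_covering:
  fixes W P :: "'a::ab_group_add set"
  assumes fin: "finite W" "finite P"
  shows "\<exists>X\<subseteq>W. card X * card P \<le> card ((\<lambda>(w, p). w + p) ` (W \<times> P)) \<and>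
    (\<forall>w\<in>W. \<exists>x\<in>X. P = {} \<or> (\<exists>p\<in>P. \<exists>q\<in>P. w + p = x + q))"
proof -
  \<comment> \<open>Disjointness of the translates is expressed as injectivity of addition on
    \<open>X \<times> P\<close>.\<close>
  have "\<exists>X\<subseteq>W. inj_on (\<lambda>(w, p). w + p) (X \<times> P) \<and>
    (\<forall>w\<in>W. \<exists>x\<in>X. P = {} \<or> (\<exists>p\<in>P. \<exists>q\<in>P. w + p = x + q))"
    using fin(1)
  proof (induction W)
    case (insert w W)
    then obtain X where X: "X \<subseteq> W" "inj_on (\<lambda>(w, p). w + p) (X \<times> P)"
      "\<forall>w\<in>W. \<exists>x\<in>X. P = {} \<or> (\<exists>p\<in>P. \<exists>q\<in>P. w + p = x + q)" by blast
    show ?case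
    proof (cases "\<exists>x\<in>X. \<exists>p\<in>P. \<exists>q\<in>P. w + p = x + q")
      case True
      then show ?thesis using X by (intro exI[of _ X]) blast
    next
      case False
      then have "inj_on (\<lambda>(w, p). w + p) (insert w X \<times> P)"
        using X(2) unfolding inj_on_def by (auto; metis)
      moreover have "\<exists>x\<in>insert w X. P = {} \<or> (\<exists>p\<in>P. \<exists>q\<in>P. u + p = x + q)" if "u \<in> insert w W" for u
        using that X(3) by blast
      ultimately show ?thesis using X(1) by (intro exI[of _ "insert w X"]) blast
    qed
  qed simp
  then obtain X where X: "X \<subseteq> W" "inj_on (\<lambda>(w, p). w + p) (X \<times> P)"
    "\<forall>w\<in>W. \<exists>x\<in>X. P = {} \<or> (\<exists>p\<in>P. \<exists>q\<in>P. w + p = x + q)" by blast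
  have "card X * card P = card ((\<lambda>(w, p). w + p) ` (X \<times> P))"
    using X(2) by (simp add: card_image card_cartesian_product)
  also have "\<dots> \<le> card ((\<lambda>(w, p). w + p) ` (W \<times> P))"
    using X(1) fin by (intro card_mono finite_imageI image_mono) auto
  finally show ?thesis using X by blast
qed

text \<open>All pairs of \<open>M\<close> are distributed over at most \<open>L * card M\<close>
  differences. The unpopular ones receive at most half of the pairs in total, and each popular one
  at most \<open>card M\<close>.\<close>

lemma popular_differences:
  fixes M :: "'a::ab_group_add set" and L :: real
  assumes fin: "finite M" and "M \<noteq> {}" "L > 0" and small: "real (card (difference_set M)) \<le> L * real (card M)"
  defines "rep \<equiv> \<lambda>s. {(u, v) \<in> M \<times> M. u - v = s}"
  defines "P \<equiv> {s \<in> difference_set M. real (card M) / (2 * L) \<le> real (card (rep s))}"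
  shows "real (card M) / 2 \<le> real (card P)"
proof -
  let ?D = "difference_set M" and ?m = "real (card M)"
  have m: "?m > 0" using assms by (simp add: card_gt_0_iff)
  have finD: "finite ?D" using fin by (rule finite_difference_set)
  have finrep: "finite (rep s)" for s by (rule finite_subset[of _ "M \<times> M"]) (auto simp: rep_def fin)
  have rep_le: "real (card (rep s)) \<le> ?m" for s
  proof -
    have "inj_on snd (rep s)" by (auto simp: inj_on_def rep_def algebra_simps)
    then have "card (rep s) = card (snd ` rep s)" by (simp add: card_image)
    also have "\<dots> \<le> card M" using fin by (intro card_mono) (auto simp: rep_def)
    finally show ?thesis by simp
  qed
  have "M \<times> M = (\<Union>s\<in>?D. rep s)" by (auto simp: rep_def difference_set_def)
  moreover have "rep s \<inter> rep t = {}" if "s \<noteq> t" for s t using that by (auto simp: rep_def)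
  ultimately have "card (M \<times> M) = (\<Sum>s\<in>?D. card (rep s))"
    by (simp add: card_UN_disjoint finD finrep)
  then have "?m * ?m = (\<Sum>s\<in>?D. real (card (rep s)))"
    by (simp add: card_cartesian_product flip: of_nat_mult of_nat_sum)
  also have "\<dots> = (\<Sum>s\<in>P. real (card (rep s))) + (\<Sum>s\<in>?D - P. real (card (rep s)))"
    using finD by (subst add.commute, intro sum.subset_diff) (auto simp: P_def)
  also have "\<dots> \<le> (\<Sum>s\<in>P. ?m) + (\<Sum>s\<in>?D - P. ?m / (2 * L))"
    by (intro add_mono sum_mono rep_le) (auto simp: P_def)
  also have "\<dots> = real (card P) * ?m + real (card (?D - P)) * (?m / (2 * L))" by simp
  also have "\<dots> \<le> real (card P) * ?m + (L * ?m) * (?m / (2 * L))"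
  proof (intro add_left_mono mult_right_mono)
    have "card (?D - P) \<le> card ?D" using finD by (intro card_mono) auto
    then show "real (card (?D - P)) \<le> L * ?m" using small by linarith
  qed (use \<open>L > 0\<close> in simp)
  also have "\<dots> = real (card P) * ?m + ?m * ?m / 2" using \<open>L > 0\<close> by (simp add: field_simps)
  finally have "?m * (?m / 2) \<le> ?m * real (card P)" by (simp add: algebra_simps)
  then show ?thesis using m by simp
qed

text \<open>
  For popular \<open>s = u\<^sub>1 - v\<^sub>1\<close>, \<open>t = u\<^sub>2 - v\<^sub>2\<close>, \<open>r = u\<^sub>3 - v\<^sub>3\<close> regroup
  \<open>a + s - t + r = (a - v\<^sub>1) + (u\<^sub>1 - u\<^sub>2) + (v\<^sub>2 - v\<^sub>3) + u\<^sub>3\<close>: each such element has many representations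
  by three differences and one element of \<open>M\<close>, hence there are few of them.
\<close>

lemma translates_absorbed:
  fixes M :: "'a::ab_group_add set" and L :: real
  assumes fin: "finite M" and ne: "M \<noteq> {}" and L: "L > 0"
    and small: "real (card (difference_set M)) \<le> L * real (card M)"
  shows "\<exists>X Q. finite X \<and> real (card X) \<le> 16 * L ^ 6 \<and> finite Q \<and> Q \<noteq> {} \<and>
    (\<forall>a\<in>M. \<forall>q\<in>Q. \<exists>x\<in>X. \<exists>q'\<in>Q. a + q = x + q')"
proof -
  let ?D = "difference_set M" and ?m = "real (card M)"
  define rep where "rep s = {(u, v) \<in> M \<times> M. u - v = s}" for s
  define P where "P = {s \<in> ?D. ?m / (2 * L) \<le> real (card (rep s))}"
  have m: "?m > 0" using fin ne by (simp add: card_gt_0_iff)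
  have P: "?m / 2 \<le> real (card P)"
    using popular_differences[OF fin ne L small] by (simp add: P_def rep_def)
  then have "P \<noteq> {}" using m by auto
  have finD: "finite ?D" using fin by (rule finite_difference_set)
  have finP: "finite P" using finD by (simp add: P_def)
  have DI: "u - v \<in> ?D" if "u \<in> M" "v \<in> M" for u v using that by (auto simp: difference_set_def)
  define W where "W = (\<lambda>(a, s, t). a + s - t) ` (M \<times> P \<times> P)"
  define Y where "Y = (\<lambda>(w, p). w + p) ` (W \<times> P)"
  have finW: "finite W" using fin finP by (simp add: W_def)
  have "\<forall>y\<in>Y. \<exists>z. case z of (a, s, t, r) \<Rightarrow> a \<in> M \<and> s \<in> P \<and> t \<in> P \<and> r \<in> P \<and> y = a + s - t + r"
  proof
    fix y assume "y \<in> Y"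
    then obtain w r where "w \<in> W" "r \<in> P" "y = w + r" by (auto simp: Y_def)
    moreover obtain a s t where "a \<in> M" "s \<in> P" "t \<in> P" "w = a + s - t"
      using \<open>w \<in> W\<close> by (auto simp: W_def)
    ultimately show "\<exists>z. case z of (a, s, t, r) \<Rightarrow> a \<in> M \<and> s \<in> P \<and> t \<in> P \<and> r \<in> P \<and> y = a + s - t + r"
      by (intro exI[of _ "(a, s, t, r)"]) simp
  qed
  from bchoice[OF this] obtain f where
    "\<forall>y\<in>Y. case f y of (a, s, t, r) \<Rightarrow> a \<in> M \<and> s \<in> P \<and> t \<in> P \<and> r \<in> P \<and> y = a + s - t + r"
    by (rule exE)
  note f = bspec[OF this]
  have "(?m / (2 * L)) ^ 3 * real (card Y) \<le> real (card (?D \<times> ?D \<times> ?D \<times> M))"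
  proof (rule card_mult_le_of_representations[where h = "\<lambda>(x, y, z, w). x + y + z + w"
        and I = "\<lambda>y. case f y of (a, s, t, r) \<Rightarrow> rep s \<times> rep t \<times> rep r"
        and g = "\<lambda>y ((u1, v1), (u2, v2), (u3, v3)). (fst (f y) - v1, u1 - u2, v2 - v3, u3)"])
    show "finite (?D \<times> ?D \<times> ?D \<times> M)" using fin finD by simp
  next
    fix y assume "y \<in> Y"
    obtain a s t r where asr: "f y = (a, s, t, r)" by (cases "f y") auto
    have "?m / (2 * L) \<le> real (card (rep s))" "?m / (2 * L) \<le> real (card (rep t))"
      "?m / (2 * L) \<le> real (card (rep r))" using f[OF \<open>y \<in> Y\<close>] asr by (auto simp: P_def)
    then have "?m / (2 * L) * (?m / (2 * L) * (?m / (2 * L))) \<le> real (card (rep s)) * (real (card (rep t)) * real (card (rep r)))"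
      using L by (intro mult_mono) auto
    then show "(?m / (2 * L)) ^ 3 \<le> real (card (case f y of (a, s, t, r) \<Rightarrow> rep s \<times> rep t \<times> rep r))"
      by (simp add: asr card_cartesian_product power3_eq_cube)
    show "inj_on (\<lambda>((u1, v1), (u2, v2), (u3, v3)). (fst (f y) - v1, u1 - u2, v2 - v3, u3))
       (case f y of (a, s, t, r) \<Rightarrow> rep s \<times> rep t \<times> rep r)"
      by (auto simp: asr inj_on_def rep_def algebra_simps)
  next
    fix y i assume "y \<in> Y" and i: "i \<in> (case f y of (a, s, t, r) \<Rightarrow> rep s \<times> rep t \<times> rep r)"
    obtain a s t r where asr: "f y = (a, s, t, r)" by (cases "f y") auto
    obtain u1 v1 u2 v2 u3 v3 where i_eq: "i = ((u1, v1), (u2, v2), (u3, v3))" by (metis surj_pair)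
    have M: "u1 \<in> M" "v1 \<in> M" "u2 \<in> M" "v2 \<in> M" "u3 \<in> M" "v3 \<in> M" "a \<in> M"
      and eqs: "s = u1 - v1" "t = u2 - v2" "r = u3 - v3" "y = a + s - t + r"
      using i f[OF \<open>y \<in> Y\<close>] by (auto simp: asr i_eq rep_def)
    have "(a - v1) + (u1 - u2) + (v2 - v3) + u3 = y" unfolding eqs by (simp add: algebra_simps)
    then show "(\<lambda>((u1, v1), (u2, v2), (u3, v3)). (fst (f y) - v1, u1 - u2, v2 - v3, u3)) i \<in> ?D \<times> ?D \<times> ?D \<times> M \<and>
        (case (\<lambda>((u1, v1), (u2, v2), (u3, v3)). (fst (f y) - v1, u1 - u2, v2 - v3, u3)) i of (x, y, z, w) \<Rightarrow> x + y + z + w) = y"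
      using M by (simp add: asr i_eq DI)
  qed
  also have "\<dots> = real (card ?D) ^ 3 * ?m" by (simp add: card_cartesian_product power3_eq_cube)
  also have "\<dots> \<le> (L * ?m) ^ 3 * ?m" using small by (intro mult_right_mono power_mono) auto
  \<comment> \<open>The constant is \<open>(2 * L) ^ 3 * L ^ 3\<close>: three popular
    representations on one side, three difference sets on the other.\<close>
  finally have "?m ^ 3 * real (card Y) \<le> ?m ^ 3 * (8 * L ^ 6 * ?m)"
    using L by (simp add: field_simps eval_nat_numeral)
  then have cY: "real (card Y) \<le> 8 * L ^ 6 * ?m" using m by simp
  obtain X where X: "X \<subseteq> W" "card X * card P \<le> card Y"
    "\<forall>w\<in>W. \<exists>x\<in>X. P = {} \<or> (\<exists>p\<in>P. \<exists>q\<in>P. w + p = x + q)"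
    using ruzsa_covering[OF finW finP] unfolding Y_def by blast
  \<comment> \<open>Since \<open>P\<close> has at least half the size of \<open>M\<close>, dividing
    by its size turns 8 into 16.\<close>
  have "real (card X) * (?m / 2) \<le> real (card X) * real (card P)" using P by (intro mult_left_mono) auto
  also have "\<dots> \<le> real (card Y)" using X(2) by (simp flip: of_nat_mult)
  finally have "?m * real (card X) \<le> ?m * (16 * L ^ 6)" using cY by (simp add: algebra_simps)
  then have "real (card X) \<le> 16 * L ^ 6" using m by simp
  \<comment> \<open>Here \<open>Q\<close> is \<open>P - P\<close>: moving \<open>p\<close> across
    the covering relation \<open>w + p = x + p'\<close> puts \<open>w\<close> into
    \<open>x + (P - P)\<close>, and \<open>W\<close> was chosen as \<open>M + P - P\<close> to
    contain every \<open>a + q\<close>.\<close>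
  moreover have "\<exists>x\<in>X. \<exists>q'\<in>difference_set P. a + q = x + q'" if aq: "a \<in> M" "q \<in> difference_set P" for a q
  proof -
    obtain s t where st: "s \<in> P" "t \<in> P" "q = s - t" using aq(2) by (auto simp: difference_set_def)
    then have "a + q \<in> W" using aq(1) by (force simp: W_def add_diff_eq)
    then obtain x p p' where "x \<in> X" "p \<in> P" "p' \<in> P" "(a + q) + p = x + p'" using X(3) \<open>P \<noteq> {}\<close> by metis
    then have "a + q = x + (p' - p)" "p' - p \<in> difference_set P"
      by (auto simp: algebra_simps difference_set_def)
    with \<open>x \<in> X\<close> show ?thesis by blast
  qed
  moreover have "finite X" using X(1) finW finite_subset by blast
  moreover have "finite (difference_set P)" "difference_set P \<noteq> {}"
    using finP \<open>P \<noteq> {}\<close> by (auto simp: difference_set_def)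
  ultimately show ?thesis by (intro exI[of _ X] exI[of _ "difference_set P"]) blast
qed

section \<open>Passing to a subspace and a dense coset\<close>

text \<open>Absorbing \<open>a\<close> step by step writes each \<open>n * a + q0\<close> as an
  integer combination of the generators plus an element of \<open>Q\<close>. Since \<open>Q\<close>
  is finite, two different \<open>n\<close> share that element, and subtraction leaves a nonzero
  multiple of \<open>a\<close> in the span.\<close>

lemma absorbed_in_qspan:
  fixes a :: "nat \<Rightarrow> int"
  assumes "finite Q" "Q \<noteq> {}" and X: "X = x ` {..<d}"
    and absorb: "\<And>q. q \<in> Q \<Longrightarrow> \<exists>y\<in>X. \<exists>q'\<in>Q. a + q = y + q'"
  shows "a \<in> qspan x d"
proof -
  obtain q0 where "q0 \<in> Q" using assms(2) by blast
  have "\<exists>q k. q \<in> Q \<and> (\<forall>p. int n * a p + q0 p = (\<Sum>i<d. k i * x i p) + q p)" for n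
  proof (induction n)
    case 0
    show ?case using \<open>q0 \<in> Q\<close> by (intro exI[of _ q0] exI[of _ "\<lambda>_. 0"]) simp
  next
    case (Suc n)
    then obtain q k where "q \<in> Q" and k: "\<And>p. int n * a p + q0 p = (\<Sum>i<d. k i * x i p) + q p" by blast
    then obtain j q' where "j < d" "q' \<in> Q" and j: "a + q = x j + q'" using absorb[of q] X by auto
    have "int (Suc n) * a p + q0 p = (\<Sum>i<d. (k i + of_bool (i = j)) * x i p) + q' p" for p
    proof -
      have "int (Suc n) * a p + q0 p = (\<Sum>i<d. k i * x i p) + (a + q) p"
        using k[of p] by (simp add: algebra_simps)
      also have "\<dots> = (\<Sum>i<d. k i * x i p) + (\<Sum>i<d. of_bool (i = j) * x i p) + q' p"
        using \<open>j < d\<close> unfolding j by (simp add: of_bool_def if_distrib[of "\<lambda>z. z * _"] cong: if_cong)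
      finally show ?thesis by (simp add: sum.distrib distrib_right)
    qed
    with \<open>q' \<in> Q\<close> show ?case by (intro exI[of _ q'] exI[of _ "\<lambda>i. k i + of_bool (i = j)"]) blast
  qed
  then obtain q k where q: "\<And>n. q n \<in> Q"
    and k: "\<And>n p. int n * a p + q0 p = (\<Sum>i<d. k n i * x i p) + q n p" by metis
  have "\<not> inj q"
    using q assms(1) by (metis finite_subset image_subset_iff infinite_UNIV_nat finite_imageD)
  then obtain m n where "m \<noteq> n" "q m = q n" by (auto simp: inj_on_def)
  have "(int m - int n) * a p = (\<Sum>i<d. (k m i - k n i) * x i p)" for p
  proof -
    have "(int m - int n) * a p = (int m * a p + q0 p) - (int n * a p + q0 p)" by (simp add: algebra_simps)
    also have "\<dots> = (\<Sum>i<d. k m i * x i p) - (\<Sum>i<d. k n i * x i p)" unfolding k \<open>q m = q n\<close> by simp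
    finally show ?thesis by (simp add: sum_subtractf left_diff_distrib)
  qed
  moreover have "int m - int n \<noteq> 0" using \<open>m \<noteq> n\<close> by simp
  ultimately show ?thesis by (rule qspanI[rotated])
qed

text \<open>Dropping every \<open>b\<close> of degree below \<open>\<eta> * n / 2\<close> loses at
  most half of the edges. As \<open>M\<close> lies in \<open>V\<close>, sums from distinct cosets
  are disjoint, and each remaining coset yields at least \<open>\<eta> * n / 2\<close> of them.
  Hence at most \<open>2 * c / \<eta>\<close> cosets remain, and one carries at least the average
  share of edges.\<close>

lemma dense_coset:
  fixes V :: "'a::ab_group_add set" and \<eta> c n :: real
  assumes V: "0 \<in> V" "\<And>y z. y \<in> V \<Longrightarrow> z \<in> V \<Longrightarrow> y - z \<in> V" and M: "M \<subseteq> V"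
    and fin: "finite M" "finite B" and G: "G \<subseteq> M \<times> B" and cards: "real (card B) \<le> n"
    and pos: "n > 0" "\<eta> > 0" "c > 0" and dense: "real (card G) \<ge> \<eta> * n\<^sup>2"
    and small: "real (card (restricted_sumset G)) \<le> c * n"
  shows "\<exists>B'\<subseteq>B. (\<forall>b\<in>B'. \<forall>b'\<in>B'. b - b' \<in> V) \<and> real (card (G \<inter> M \<times> B')) \<ge> \<eta>\<^sup>2 / (4 * c) * n\<^sup>2"
proof -
  have Vsum: "y + z \<in> V" if "y \<in> V" "z \<in> V" for y z
    using V(2)[OF that(1) V(2)[OF V(1) that(2)]] by simp
  define deg where "deg b = card {a. (a, b) \<in> G}" for b
  define B1 where "B1 = {b \<in> B. real (deg b) \<ge> \<eta> * n / 2}"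
  define cls where "cls b = {b' \<in> B1. b' - b \<in> V}" for b
  have finG: "finite G" using G fin by (meson finite_SigmaI finite_subset)
  have finB1: "finite B1" using fin by (simp add: B1_def)
  define E where "E K = {(a, b) \<in> G. b \<in> K}" for K
  have finE: "finite (E K)" for K using finG by (rule finite_subset[rotated]) (auto simp: E_def)
  have cls_self: "b \<in> cls b" if "b \<in> B1" for b using that V(1) by (simp add: cls_def)
  have cls_diff: "b - b' \<in> V" if "b \<in> cls u" "b' \<in> cls u" for b b' u
    using V(2)[of "b - u" "b' - u"] that by (simp add: cls_def)
  have cls_eq: "cls b = cls b'" if "b - b' \<in> V" for b b'
  proof -
    have "z - b' \<in> V" if "z - b \<in> V" for z using Vsum[OF that \<open>b - b' \<in> V\<close>] by simp
    moreover have "z - b \<in> V" if "z - b' \<in> V" for z using V(2)[OF that \<open>b - b' \<in> V\<close>] by simp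
    ultimately show ?thesis by (auto simp: cls_def)
  qed
  let ?C = "cls ` B1"
  have disj: "K = K'" if K: "K \<in> ?C" "K' \<in> ?C" "b \<in> K" "b' \<in> K'" "b - b' \<in> V" for K K' b b'
  proof -
    obtain u u' where u: "K = cls u" "K' = cls u'" using K by blast
    have "cls u = cls b" "cls u' = cls b'"
      using K(3,4) cls_eq[of b u] cls_eq[of b' u'] unfolding u by (auto simp: cls_def)
    then show ?thesis using u cls_eq[OF K(5)] by simp
  qed
  have finC: "finite ?C" using finB1 by simp
  have sums: "real (card ?C) * (\<eta> * n / 2) \<le> c * n"
  proof -
    have finS: "finite (restricted_sumset (E K))" for K
      unfolding restricted_sumset_eq_image using finE by simp
    have "\<eta> * n / 2 \<le> real (card (restricted_sumset (E K)))" if "K \<in> ?C" for K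
    proof -
      \<comment> \<open>The sums of a single \<open>b\<close> with its neighbours are already
        distinct and numerous enough.\<close>
      obtain b where b: "b \<in> B1" "b \<in> K" using \<open>K \<in> ?C\<close> cls_self by blast
      have "deg b = card ((\<lambda>a. a + b) ` {a. (a, b) \<in> G})"
        unfolding deg_def by (subst card_image) (auto simp: inj_on_def)
      also have "\<dots> \<le> card (restricted_sumset (E K))"
        by (rule card_mono[OF finS]) (use b in \<open>auto simp: restricted_sumset_def E_def\<close>)
      finally show ?thesis using b(1) by (simp add: B1_def)
    qed
    then have "real (card ?C) * (\<eta> * n / 2) \<le> (\<Sum>K\<in>?C. real (card (restricted_sumset (E K))))"
      using sum_mono[of ?C "\<lambda>_. \<eta> * n / 2" "\<lambda>K. real (card (restricted_sumset (E K)))"] by simp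
    also have "\<dots> = real (card (\<Union>K\<in>?C. restricted_sumset (E K)))"
    proof (subst card_UN_disjoint)
      show "\<forall>K\<in>?C. \<forall>K'\<in>?C. K \<noteq> K' \<longrightarrow> restricted_sumset (E K) \<inter> restricted_sumset (E K') = {}"
      proof (intro ballI impI, rule ccontr)
        fix K K' assume K: "K \<in> ?C" "K' \<in> ?C" "K \<noteq> K'"
          and "restricted_sumset (E K) \<inter> restricted_sumset (E K') \<noteq> {}"
        then obtain a b a' b' where ab: "(a, b) \<in> G" "b \<in> K" "(a', b') \<in> G" "b' \<in> K'" "a + b = a' + b'"
          by (auto simp: restricted_sumset_def E_def)
        then have "a' - a \<in> V" using M G by (intro V(2)) auto
        moreover have "a' - a = b - b'" using ab(5) by (simp add: algebra_simps)
        ultimately show False using disj[OF K(1,2) ab(2,4)] K(3) by simp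
      qed
    qed (use finC finS in auto)
    also have "\<dots> \<le> real (card (restricted_sumset G))"
      unfolding restricted_sumset_eq_image using finG
      by (intro of_nat_mono card_mono) (auto simp: E_def)
    finally show ?thesis using small by linarith
  qed
  have "\<eta> * n\<^sup>2 / 2 \<le> real (card (E B1))"
  proof -
    have "card G = card (E B1 \<union> (\<Union>b\<in>B - B1. {a. (a, b) \<in> G} \<times> {b}))"
      by (rule arg_cong[of _ _ card]) (use G in \<open>auto simp: E_def\<close>)
    also have "\<dots> \<le> card (E B1) + card (\<Union>b\<in>B - B1. {a. (a, b) \<in> G} \<times> {b})" by (rule card_Un_le)
    also have "\<dots> \<le> card (E B1) + (\<Sum>b\<in>B - B1. card ({a. (a, b) \<in> G} \<times> {b}))"
      using fin by (intro add_left_mono card_UN_le) auto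
    finally have "real (card G) \<le> real (card (E B1)) + (\<Sum>b\<in>B - B1. real (deg b))"
      by (simp add: card_cartesian_product deg_def flip: of_nat_sum of_nat_add)
    also have "(\<Sum>b\<in>B - B1. real (deg b)) \<le> (\<Sum>b\<in>B - B1. \<eta> * n / 2)"
      by (intro sum_mono) (auto simp: B1_def)
    also have "\<dots> = real (card (B - B1)) * (\<eta> * n / 2)" by simp
    also have "\<dots> \<le> n * (\<eta> * n / 2)"
    proof (rule mult_right_mono)
      have "card (B - B1) \<le> card B" using fin by (intro card_mono) auto
      then show "real (card (B - B1)) \<le> n" using cards by linarith
    qed (use pos in simp)
    finally show ?thesis using dense by (simp add: power2_eq_square algebra_simps)
  qed
  also have "card (E B1) \<le> card (\<Union>K\<in>?C. E K)"
    by (rule card_mono) (use finB1 finE cls_self in \<open>auto simp: E_def\<close>)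
  also have "\<dots> \<le> (\<Sum>K\<in>?C. card (E K))" by (rule card_UN_le[OF finC])
  finally have edges: "\<eta> * n\<^sup>2 / 2 \<le> (\<Sum>K\<in>?C. real (card (E K)))" by (simp only: of_nat_sum)
  have "\<exists>K\<in>?C. real (card (E K)) \<ge> \<eta>\<^sup>2 / (4 * c) * n\<^sup>2"
  proof (rule ccontr)
    assume "\<not> ?thesis"
    then have less: "real (card (E K)) < \<eta>\<^sup>2 / (4 * c) * n\<^sup>2" if "K \<in> ?C" for K using that by force
    have "\<eta> * n\<^sup>2 / 2 > 0" using pos by simp
    then have "?C \<noteq> {}" using edges by auto
    then have "(\<Sum>K\<in>?C. real (card (E K))) < (\<Sum>K\<in>?C. \<eta>\<^sup>2 / (4 * c) * n\<^sup>2)"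
      using finC less by (intro sum_strict_mono) auto
    also have "\<dots> = (real (card ?C) * (\<eta> * n / 2)) * (\<eta> * n / (2 * c))"
      by (simp add: power2_eq_square)
    also have "\<dots> \<le> (c * n) * (\<eta> * n / (2 * c))" using sums pos by (intro mult_right_mono) auto
    also have "\<dots> = \<eta> * n\<^sup>2 / 2" using pos by (simp add: power2_eq_square)
    finally show False using edges by simp
  qed
  then obtain K where K: "K \<in> ?C" "real (card (E K)) \<ge> \<eta>\<^sup>2 / (4 * c) * n\<^sup>2" by blast
  have "E K = G \<inter> M \<times> K" using G by (auto simp: E_def)
  moreover have "K \<subseteq> B" using K(1) by (auto simp: cls_def B1_def)
  moreover have "\<forall>b\<in>K. \<forall>b'\<in>K. b - b' \<in> V" using K(1) cls_diff by auto
  ultimately show ?thesis using K(2) by (intro exI[of _ K]) simp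
qed

text \<open>Vertices of low degree are removed before the subset \<open>M\<close> is chosen; the
  factor 2 in the density pays for this. Every element of \<open>M\<close> then keeps degree at
  least \<open>\<delta> * card A\<close>, so \<open>M\<close> carries density
  \<open>\<delta>\<^sup>2 / 4\<close>, the value of \<open>\<eta>\<close> passed to
  \<open>dense_coset\<close>.\<close>

lemma structured_subgraph:
  fixes A :: "(nat \<Rightarrow> int) set" and \<delta> c :: real
  assumes fin: "finite A" and ne: "A \<noteq> {}" and G: "G \<subseteq> A \<times> A" and pos: "\<delta> > 0" "c > 0"
    and dense: "real (card G) \<ge> 2 * \<delta> * (real (card A))\<^sup>2"
    and small: "real (card (restricted_sumset G)) \<le> c * real (card A)"
  shows "\<exists>M B x d. M \<subseteq> A \<and> B \<subseteq> A \<and> real d \<le> 16 * (16384 * c ^ 4 / \<delta> ^ 6) ^ 6 \<and>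
    (\<forall>a\<in>M. \<forall>b\<in>M. a - b \<in> qspan x d) \<and> (\<forall>a\<in>B. \<forall>b\<in>B. a - b \<in> qspan x d) \<and>
    real (card (G \<inter> M \<times> B)) \<ge> (\<delta>\<^sup>2 / 4)\<^sup>2 / (4 * c) * (real (card A))\<^sup>2"
proof -
  let ?n = "real (card A)" and ?L = "16384 * c ^ 4 / \<delta> ^ 6"
  have n: "?n > 0" using fin ne by (simp add: card_gt_0_iff)
  have finG: "finite G" using fin by (intro finite_subset[OF G]) simp
  define deg where "deg a = card {b. (a, b) \<in> G}" for a
  define A1 where "A1 = {a \<in> A. real (deg a) \<ge> \<delta> * ?n}"
  define G1 where "G1 = {(a, b) \<in> G. a \<in> A1}"
  have A1: "A1 \<subseteq> A" "finite A1" using fin by (auto simp: A1_def)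
  have G1: "G1 \<subseteq> A1 \<times> A" "G1 \<subseteq> G" using G by (auto simp: G1_def)
  have "card G = card (G1 \<union> (\<Union>a\<in>A - A1. {a} \<times> {b. (a, b) \<in> G}))"
    by (rule arg_cong[of _ _ card]) (use G in \<open>auto simp: G1_def\<close>)
  also have "\<dots> \<le> card G1 + card (\<Union>a\<in>A - A1. {a} \<times> {b. (a, b) \<in> G})" by (rule card_Un_le)
  also have "\<dots> \<le> card G1 + (\<Sum>a\<in>A - A1. card ({a} \<times> {b. (a, b) \<in> G}))"
    using fin by (intro add_left_mono card_UN_le) auto
  finally have "real (card G) \<le> real (card G1) + (\<Sum>a\<in>A - A1. real (deg a))"
    by (simp add: card_cartesian_product deg_def flip: of_nat_sum of_nat_add)
  also have "(\<Sum>a\<in>A - A1. real (deg a)) \<le> (\<Sum>a\<in>A - A1. \<delta> * ?n)" by (intro sum_mono) (auto simp: A1_def)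
  also have "\<dots> = real (card (A - A1)) * (\<delta> * ?n)" by simp
  also have "\<dots> \<le> ?n * (\<delta> * ?n)"
    using fin pos by (intro mult_right_mono of_nat_mono card_mono) auto
  finally have dense1: "real (card G1) \<ge> \<delta> * ?n\<^sup>2" using dense by (simp add: power2_eq_square algebra_simps)
  have sumset_mono: "real (card (restricted_sumset H)) \<le> c * ?n" if "H \<subseteq> G" for H
  proof -
    have "card (restricted_sumset H) \<le> card (restricted_sumset G)"
      unfolding restricted_sumset_eq_image using that finG by (intro card_mono finite_imageI image_mono)
    then show ?thesis using small by linarith
  qed
  have "real (card A1) \<le> ?n" using A1 fin by (simp add: card_mono)
  then obtain M where M: "M \<subseteq> A1" "real (card M) \<ge> \<delta> * ?n / 4"
    and D: "real (card (difference_set M)) \<le> 4096 * c ^ 4 / \<delta> ^ 5 * ?n"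
    using balog_szemeredi_gowers_differences[OF A1(2) fin G1(1) _ order.refl n pos(1) dense1 sumset_mono[OF G1(2)]]
    by blast
  have finM: "finite M" "M \<subseteq> A" using M(1) A1 finite_subset by auto
  have "\<delta> * ?n / 4 > 0" using pos n by simp
  then have "M \<noteq> {}" using M(2) by auto
  have L: "?L > 0" using pos by simp
  note D
  \<comment> \<open>The difference set is now measured against \<open>card M\<close>, which costs a
    factor \<open>4 / \<delta>\<close> and explains 16384.\<close>
  also have "4096 * c ^ 4 / \<delta> ^ 5 * ?n = ?L * (\<delta> * ?n / 4)" using pos by (simp add: field_simps eval_nat_numeral)
  also have "\<dots> \<le> ?L * real (card M)" using M(2) L by (intro mult_left_mono) auto
  finally obtain X Q where X: "finite X" "real (card X) \<le> 16 * ?L ^ 6"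
    and Q: "finite Q" "Q \<noteq> {}" "\<forall>a\<in>M. \<forall>q\<in>Q. \<exists>x\<in>X. \<exists>q'\<in>Q. a + q = x + q'"
    using translates_absorbed[OF finM(1) \<open>M \<noteq> {}\<close> L] by blast
  obtain x where "bij_betw x {0..<card X} X" using ex_bij_betw_nat_finite[OF X(1)] by blast
  then have x: "X = x ` {..<card X}" by (simp add: bij_betw_def atLeast0LessThan)
  let ?V = "qspan x (card X)"
  have MV: "M \<subseteq> ?V" using absorbed_in_qspan[OF Q(1,2) x] Q(3) by blast
  define G2 where "G2 = G \<inter> M \<times> A"
  have "(\<delta> * ?n) * real (card M) \<le> real (card G2)"
  proof (rule card_mult_le_of_representations[where h = fst and g = Pair and I = "\<lambda>a. {b. (a, b) \<in> G}"])
    show "\<delta> * ?n \<le> real (card {b. (a, b) \<in> G})" if "a \<in> M" for a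
      using that M(1) by (auto simp: A1_def deg_def)
  qed (use finG G in \<open>auto simp: G2_def inj_on_def\<close>)
  moreover have "(\<delta> * ?n) * (\<delta> * ?n / 4) \<le> (\<delta> * ?n) * real (card M)"
    using M(2) pos by (intro mult_left_mono) auto
  ultimately have dense2: "real (card G2) \<ge> \<delta>\<^sup>2 / 4 * ?n\<^sup>2" by (simp add: power2_eq_square algebra_simps)
  have "\<exists>B\<subseteq>A. (\<forall>b\<in>B. \<forall>b'\<in>B. b - b' \<in> ?V) \<and> real (card (G2 \<inter> M \<times> B)) \<ge> (\<delta>\<^sup>2 / 4)\<^sup>2 / (4 * c) * ?n\<^sup>2"
  proof (rule dense_coset[OF qspan_zero qspan_diff MV finM(1) fin _ order.refl n _ pos(2) dense2 sumset_mono])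
    show "G2 \<subseteq> M \<times> A" "G2 \<subseteq> G" by (auto simp: G2_def)
    show "\<delta>\<^sup>2 / 4 > 0" using pos by simp
  qed
  then obtain B where B: "B \<subseteq> A" "\<forall>b\<in>B. \<forall>b'\<in>B. b - b' \<in> ?V"
    "real (card (G2 \<inter> M \<times> B)) \<ge> (\<delta>\<^sup>2 / 4)\<^sup>2 / (4 * c) * ?n\<^sup>2" by blast
  have "G2 \<inter> M \<times> B = G \<inter> M \<times> B" using B(1) by (auto simp: G2_def)
  moreover have "\<forall>a\<in>M. \<forall>b\<in>M. a - b \<in> ?V" using MV qspan_diff by blast
  ultimately show ?thesis using B finM(2) X(2)
    by (intro exI[of _ M] exI[of _ B] exI[of _ x] exI[of _ "card X"]) simp
qed

section \<open>From energy to the number of sums along the graph\<close>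

text \<open>Cauchy--Schwarz between the sum map on \<open>H\<close> and the identity on its image:
  their coincidences number exactly \<open>card H\<close>, and those of the sum map with itself are
  among the solutions counted for \<open>M\<close> and \<open>B\<close>.\<close>

lemma card_sq_le_sumset_times_solutions:
  assumes "finite M" "finite B" "H \<subseteq> M \<times> B"
  shows "(real (card H))\<^sup>2 \<le> real (card (restricted_sumset H)) * real (sum_solutions M B M B)"
proof -
  let ?s = "\<lambda>(a, b). a + b :: nat" and ?S = "restricted_sumset H"
  have finH: "finite H" using assms finite_subset by blast
  then have finS: "finite ?S" by (simp add: restricted_sumset_eq_image)
  have "coincidences ?s H id ?S = card ((\<lambda>h. (h, ?s h)) ` H)"
    unfolding coincidences_def restricted_sumset_eq_image by (rule arg_cong[of _ _ card]) auto
  also have "\<dots> = card H" by (intro card_image) (auto simp: inj_on_def)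
  finally have 1: "coincidences ?s H id ?S = card H" .
  have "coincidences id ?S id ?S = card ((\<lambda>h. (h, h)) ` ?S)"
    unfolding coincidences_def by (rule arg_cong[of _ _ card]) auto
  also have "\<dots> = card ?S" by (intro card_image) (auto simp: inj_on_def)
  finally have 2: "coincidences id ?S id ?S = card ?S" .
  have "coincidences ?s H ?s H \<le> sum_solutions M B M B"
    unfolding sum_solutions_def coincidences_def
    by (rule card_mono, rule finite_subset[of _ "(M \<times> B) \<times> (M \<times> B)"]) (use assms in auto)
  then have "real (coincidences ?s H ?s H) * real (card ?S) \<le> real (sum_solutions M B M B) * real (card ?S)"
    by (intro mult_right_mono) auto
  moreover have "(real (card H))\<^sup>2 \<le> real (coincidences ?s H ?s H) * real (card ?S)"
    using coincidences_sq_le[OF finH finS, of ?s id] unfolding 1 2 .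
  ultimately show ?thesis by (simp add: mult.commute)
qed

theorem theorem3:
  shows "\<forall>\<delta>::real. \<forall>c::real. \<delta> > 0 \<longrightarrow> c > 0 \<longrightarrow>
    (\<exists>C::real. C > 0 \<and>
      (\<forall>(A::nat set) (G::(nat \<times> nat) set).
        finite A \<longrightarrow> A \<noteq> {} \<longrightarrow> (\<forall>a\<in>A. a > 0) \<longrightarrow>
        G \<subseteq> A \<times> A \<longrightarrow> real (card G) > \<delta> * (real (card A))\<^sup>2 \<longrightarrow>
        real (card (restricted_prodset G)) < c * real (card A) \<longrightarrow>
        real (card (restricted_sumset G)) > C * (real (card A))\<^sup>2))"
proof (intro allI impI)
  fix \<delta> c :: real assume pos: "\<delta> > 0" "c > 0"
  \<comment> \<open>\<open>D\<close> bounds the dimension and \<open>\<theta>\<close> the edge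
    density supplied by \<open>structured_subgraph\<close> with \<open>\<delta> / 2\<close>; both
    depend only on \<open>\<delta>\<close> and \<open>c\<close>. In \<open>C\<close>,
    \<open>36 ^ D\<close> is the product of the two energy factors \<open>6 ^ D\<close>, and the 2
    makes the final inequality strict.\<close>
  define D where "D = nat \<lfloor>16 * (16384 * c ^ 4 / (\<delta> / 2) ^ 6) ^ 6\<rfloor>"
  define \<theta> where "\<theta> = ((\<delta> / 2)\<^sup>2 / 4)\<^sup>2 / (4 * c)"
  define C where "C = \<theta>\<^sup>2 / (2 * 36 ^ D)"
  have \<theta>: "\<theta> > 0" using pos by (simp add: \<theta>_def)
  then have C: "C > 0" by (simp add: C_def)
  have "real (card (restricted_sumset G)) > C * (real (card A))\<^sup>2"
    if fin: "finite A" and ne: "A \<noteq> {}" and A_pos: "\<forall>a\<in>A. a > 0" and G: "G \<subseteq> A \<times> A"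
      and dense: "real (card G) > \<delta> * (real (card A))\<^sup>2"
      and small: "real (card (restricted_prodset G)) < c * real (card A)"
    for A :: "nat set" and G :: "(nat \<times> nat) set"
  proof -
    let ?n = "real (card A)" and ?v = "map_prod valuation valuation"
    have n: "?n > 0" using fin ne by (simp add: card_gt_0_iff)
    have finG: "finite G" using fin by (intro finite_subset[OF G]) simp
    have inj: "inj_on valuation A" using A_pos valuation_inject by (meson inj_onI)
    have inj2: "inj_on ?v (A \<times> A)" using inj by (simp add: map_prod_inj_on)
    have card_vA: "card (valuation ` A) = card A" using inj by (rule card_image)
    have card_vG: "card (?v ` G) = card G" using inj2 G by (intro card_image) (rule inj_on_subset)
    have "restricted_sumset (?v ` G) = valuation ` restricted_prodset G"
    proof -
      have "valuation a + valuation b = valuation (a * b)" if "(a, b) \<in> G" for a b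
        using that G A_pos by (subst valuation_mult) auto
      then show ?thesis
        unfolding restricted_sumset_eq_image restricted_prodset_def by (force simp: image_iff)
    qed
    moreover have "restricted_prodset G = (\<lambda>(a, b). a * b) ` G"
      by (auto simp: restricted_prodset_def image_iff Bex_def split: prod.splits)
    then have "finite (restricted_prodset G)" using finG by simp
    ultimately have "card (restricted_sumset (?v ` G)) \<le> card (restricted_prodset G)"
      by (simp add: card_image_le)
    then have small': "real (card (restricted_sumset (?v ` G))) \<le> c * real (card (valuation ` A))"
      using small card_vA by simp
    have "?v ` G \<subseteq> valuation ` A \<times> valuation ` A" using G by auto
    moreover have "real (card (?v ` G)) \<ge> 2 * (\<delta> / 2) * (real (card (valuation ` A)))\<^sup>2"
      using dense card_vA card_vG by simp
    ultimately obtain M' B' x d where MB': "M' \<subseteq> valuation ` A" "B' \<subseteq> valuation ` A"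
      and d: "real d \<le> 16 * (16384 * c ^ 4 / (\<delta> / 2) ^ 6) ^ 6"
      and spans: "\<forall>a\<in>M'. \<forall>b\<in>M'. a - b \<in> qspan x d" "\<forall>a\<in>B'. \<forall>b\<in>B'. a - b \<in> qspan x d"
      and many: "real (card (?v ` G \<inter> M' \<times> B')) \<ge> \<theta> * ?n\<^sup>2"
      using structured_subgraph[of "valuation ` A" "?v ` G" "\<delta> / 2" c] fin ne pos small' card_vA
      unfolding \<theta>_def by auto
    \<comment> \<open>The structured sets are pulled back to integers, since the energy estimate
      concerns sums of the integers themselves.\<close>
    define M where "M = {a \<in> A. valuation a \<in> M'}"
    define B where "B = {a \<in> A. valuation a \<in> B'}"
    define H where "H = G \<inter> M \<times> B"
    have MA: "M \<subseteq> A" "B \<subseteq> A" by (auto simp: M_def B_def)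
    have finMB: "finite M" "finite B" using MA fin finite_subset by auto
    have "?v ` G \<inter> M' \<times> B' = ?v ` H" using G by (auto simp: H_def M_def B_def)
    moreover have "card (?v ` H) = card H"
      using inj2 G by (intro card_image) (auto simp: H_def intro: inj_on_subset)
    ultimately have card_H: "real (card H) \<ge> \<theta> * ?n\<^sup>2" using many by simp
    have energy_bound: "sqrt (energy Y) \<le> 6 ^ D * ?n"
      if "Y \<subseteq> A" "\<And>a b. a \<in> Y \<Longrightarrow> b \<in> Y \<Longrightarrow> valuation a - valuation b \<in> qspan x d" for Y
    proof -
      have "sqrt (energy Y) \<le> 6 ^ d * real (card Y)"
        using that A_pos fin finite_subset[OF that(1) fin] by (intro sqrt_energy_le_of_qspan) auto
      also have "\<dots> \<le> 6 ^ D * ?n"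
      proof (intro mult_mono power_increasing)
        show "d \<le> D" using d unfolding D_def by (simp add: le_nat_iff le_floor_iff)
        show "real (card Y) \<le> ?n" using that(1) fin by (simp add: card_mono)
      qed auto
      finally show ?thesis .
    qed
    have "real (sum_solutions M B M B) \<le> sqrt (real (energy M) * real (energy B))"
      using sum_solutions_sq_le_energy[OF finMB] by (simp add: real_le_rsqrt)
    also have "\<dots> = sqrt (energy M) * sqrt (energy B)" by (rule real_sqrt_mult)
    also have "\<dots> \<le> (6 ^ D * ?n) * (6 ^ D * ?n)"
      using MA spans by (intro mult_mono energy_bound) (auto simp: M_def B_def)
    also have "\<dots> = 36 ^ D * ?n\<^sup>2" by (simp add: power2_eq_square flip: power_mult_distrib)
    finally have sols: "real (sum_solutions M B M B) \<le> 36 ^ D * ?n\<^sup>2" .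
    have "(\<theta> * ?n\<^sup>2)\<^sup>2 \<le> (real (card H))\<^sup>2" using card_H \<theta> by (intro power_mono) auto
    also have "\<dots> \<le> real (card (restricted_sumset H)) * real (sum_solutions M B M B)"
      using finMB by (intro card_sq_le_sumset_times_solutions) (auto simp: H_def)
    also have "\<dots> \<le> real (card (restricted_sumset G)) * (36 ^ D * ?n\<^sup>2)"
    proof (intro mult_mono sols of_nat_mono card_mono)
      show "finite (restricted_sumset G)" using finG by (simp add: restricted_sumset_eq_image)
    qed (auto simp: H_def restricted_sumset_def)
    finally have "?n\<^sup>2 * (\<theta>\<^sup>2 * ?n\<^sup>2) \<le> ?n\<^sup>2 * (real (card (restricted_sumset G)) * 36 ^ D)"
      by (simp add: power_mult_distrib power2_eq_square algebra_simps)
    then have "\<theta>\<^sup>2 * ?n\<^sup>2 \<le> real (card (restricted_sumset G)) * 36 ^ D" using n by simp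
    then have "2 * (C * ?n\<^sup>2) \<le> real (card (restricted_sumset G))" by (simp add: C_def field_simps)
    moreover have "C * ?n\<^sup>2 > 0" using C n by simp
    ultimately show ?thesis by linarith
  qed
  with C show "\<exists>C>0. \<forall>(A::nat set) (G::(nat \<times> nat) set).
        finite A \<longrightarrow> A \<noteq> {} \<longrightarrow> (\<forall>a\<in>A. a > 0) \<longrightarrow>
        G \<subseteq> A \<times> A \<longrightarrow> real (card G) > \<delta> * (real (card A))\<^sup>2 \<longrightarrow>
        real (card (restricted_prodset G)) < c * real (card A) \<longrightarrow>
        real (card (restricted_sumset G)) > C * (real (card A))\<^sup>2"
    by blast
qed

end
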